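(* Let $m\in\mathbb N$ and let $f_0,f_1,\dots,f_m$ be $m+1$ infinite real vectors (sequences) $f_r=(f_{rk})_{k\in\mathbb N}$, $f_{rk}\in\mathbb R$, $0\le r\le m$, such that for all $(C_0,\dots,C_m)\in\mathbb R^{m+1}\setminus\{0\}$ one has $\sum_{r=0}^m C_r f_r\notin l_2(\mathbb N)$, i.e. $$\sum_{k\in\mathbb N}\Big|\sum_{r=0}^m C_r f_{rk}\Big|^2=\infty .$$ For $n\in\mathbb N$ denote by $f_r^{(n)}=(f_{rk})_{k=1}^n\in\mathbb R^n$ the projection of $f_r$ onto the first $n$ coordinates. Then for every $s$ with $0\le s\le m$, $$\lim_{n\to\infty}\frac{\Gamma\big(f_0^{(n)},f_1^{(n)},\dots,f_m^{(n)}\big)}{\Gamma\big(f_0^{(n)},\dots,\widehat{f_s^{(n)}},\dots,f_m^{(n)}\big)}=\infty,$$ where the hat means that the vector $f_s^{(n)}$ is omitted.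
   Context: $\mathbb N=\{1,2,3,\dots\}$. For vectors $x_1,\dots,x_p$ in a real Hilbert space (here $\mathbb R^n$ with its standard inner product $(\cdot,\cdot)$), the Gram matrix is $\gamma(x_1,\dots,x_p)=\big((x_k,x_l)\big)_{k,l=1}^p$ and the Gram determinant is $\Gamma(x_1,\dots,x_p)=\det\gamma(x_1,\dots,x_p)$. $l_2(\mathbb N)$ is the space of real square-summable sequences. The quotient is considered for those (sufficiently large) $n$ for which its denominator is nonzero. *)

theory Defs
  imports "HOL-Analysis.Infinite_Sum" "Jordan_Normal_Form.Determinant"
begin

(* A sequence indexed by 1, 2, 3, ... is a function on nat whose value at 0 is never used. *)

definition l2_seq :: "(nat \<Rightarrow> real) set" where
  "l2_seq = {x. (\<lambda>k. \<bar>x k\<bar>\<^sup>2) summable_on {1..}}"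

(* vec is 0-based: entry i of the vector is the (i + 1)-st coordinate of the sequence. *)
definition proj_vec :: "nat \<Rightarrow> (nat \<Rightarrow> real) \<Rightarrow> real vec" where
  "proj_vec n x = vec n (\<lambda>i. x (Suc i))"

definition gram_mat :: "real vec list \<Rightarrow> real mat" where
  "gram_mat xs = mat (length xs) (length xs) (\<lambda>(k, l). scalar_prod (xs ! k) (xs ! l))"

definition gram_det :: "real vec list \<Rightarrow> real" where
  "gram_det xs = det (gram_mat xs)"

end

theory Submission
  imports Defs "HOL-Analysis.Elementary_Normed_Spaces"
begin

text \<open>
  Write \<open>Q\<^sub>n(C)\<close> for the squared length of \<open>\<Sum>\<^sub>r C\<^sub>r f\<^sub>r\<^sup>(\<^sup>n\<^sup>)\<close>, which is the value at \<open>C\<close> of the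
  quadratic form of the Gram matrix.  A Gram quotient with nonzero denominator is the squared distance
  from \<open>f\<^sub>s\<^sup>(\<^sup>n\<^sup>)\<close> to the span of the other vectors, but the proof needs less: that the
  quotient is a value \<open>Q\<^sub>n(C)\<close> at some \<open>C\<close> that has an entry of modulus at least \<open>1\<close>.  The column \<open>s\<close> of the adjugate matrix, divided by
  the principal minor, is such a \<open>C\<close>, with \<open>C\<^sub>s = 1\<close>
  (\<open>det_quotient_is_quadratic_form_value\<close>).  If the minor is zero, the quotient is \<open>0\<close> by the
  convention on division, and a multiple of a kernel vector of the submatrix serves instead, so one
  bound covers all \<open>n\<close>.

  It remains to see that \<open>Q\<^sub>n\<close> tends to infinity uniformly on these \<open>C\<close>
  (\<open>uniform_divergence_of_partial_energies\<close>).  Since \<open>Q\<^sub>n\<close> increases with \<open>n\<close> and is homogeneous, a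
  failure would give for every \<open>n\<close> a \<open>D\<close> on the \<open>l\<^sub>1\<close> unit sphere with \<open>Q\<^sub>n(D) \<le> M\<close>.  That sphere is
  compact, and a limit point \<open>L \<noteq> 0\<close> satisfies \<open>Q\<^sub>N(L) \<le> M\<close> for all \<open>N\<close>, so that
  \<open>\<Sum>\<^sub>r L\<^sub>r f\<^sub>r\<close> is square-summable, which the hypothesis excludes.
\<close>

(* The index notation for vectors refers to the type of the Gram matrices, not to Cartesian powers. *)
unbundle no vec_syntax

section \<open>Uniform divergence of the partial energies\<close>

lemma bounded_sequences_common_convergent_subsequence:
  fixes D :: "nat \<Rightarrow> 'i \<Rightarrow> real"
  assumes "finite I" and bound: "\<And>n i. i \<in> I \<Longrightarrow> \<bar>D n i\<bar> \<le> B"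
  obtains \<sigma> L where "strict_mono \<sigma>" "\<And>i. i \<in> I \<Longrightarrow> (\<lambda>n. D (\<sigma> n) i) \<longlonglongrightarrow> L i"
proof -
  have "\<forall>\<delta>\<subseteq>I. \<exists>L \<sigma>. strict_mono \<sigma> \<and>
      (\<forall>e>0. eventually (\<lambda>n. \<forall>i\<in>\<delta>. dist (D (\<sigma> n) i) (L i) < e) sequentially)"
  proof (rule compact_lemma_general[where proj = "\<lambda>x i. x i" and unproj = "\<lambda>x. x"])
    fix i assume "i \<in> I"
    then show "bounded ((\<lambda>x. x i) ` range D)"
      using bound by (auto simp: bounded_iff)
  qed (use assms(1) in auto)
  then obtain L \<sigma> where \<sigma>: "strict_mono \<sigma>"
    and lim: "\<And>e. e > 0 \<Longrightarrow> \<forall>\<^sub>F n in sequentially. \<forall>i\<in>I. dist (D (\<sigma> n) i) (L i) < e"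
    by blast
  have "(\<lambda>n. D (\<sigma> n) i) \<longlonglongrightarrow> L i" if "i \<in> I" for i
  proof (rule tendstoI)
    fix e :: real
    assume "0 < e"
    from lim[OF this] show "\<forall>\<^sub>F n in sequentially. dist (D (\<sigma> n) i) (L i) < e"
      by (rule eventually_mono) (use that in blast)
  qed
  with \<sigma> show ?thesis by (rule that)
qed

lemma bounded_partial_energies_imp_l2_seq:
  assumes "\<And>N. (\<Sum>j<N. (x (Suc j))\<^sup>2) \<le> M"
  shows "x \<in> l2_seq"
proof -
  have "(\<Sum>j\<le>N. (x (Suc j))\<^sup>2) \<le> M" for N
    using assms[of "Suc N"] by (simp only: lessThan_Suc_atMost)
  then have "summable (\<lambda>j. (x (Suc j))\<^sup>2)"
    by (intro bounded_imp_summable[where B = M]) simp_all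
  then have "(\<lambda>j. (x (Suc j))\<^sup>2) summable_on UNIV"
    by (intro norm_summable_imp_summable_on) simp
  then have "((\<lambda>k. (x k)\<^sup>2) \<circ> Suc) summable_on UNIV"
    by (simp add: o_def)
  then have "(\<lambda>k. (x k)\<^sup>2) summable_on range Suc"
    by (subst summable_on_reindex) simp_all
  moreover have "range Suc = {1..}"
    by (auto simp: image_iff) (metis Suc_le_D)
  ultimately show ?thesis
    by (simp add: l2_seq_def)
qed

text \<open>
  A bounded family of partial energies would have a limit point with square-summable combination, by
  compactness of the unit sphere.  Normalising by \<open>\<Sum>\<^sub>r \<bar>C\<^sub>r\<bar>\<close>, and not by the largest entry, keeps the
  constraint a single continuous equation, which visibly passes to the limit.
\<close>

lemma uniform_divergence_of_partial_energies:
  fixes f :: "nat \<Rightarrow> nat \<Rightarrow> real"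
  assumes non_l2: "\<And>C :: nat \<Rightarrow> real. \<exists>r\<le>m. C r \<noteq> 0 \<Longrightarrow> (\<lambda>k. \<Sum>r=0..m. C r * f r k) \<notin> l2_seq"
  shows "\<forall>\<^sub>F n in sequentially. \<forall>C. (\<exists>r\<le>m. 1 \<le> \<bar>C r\<bar>) \<longrightarrow>
           M < (\<Sum>j<n. (\<Sum>r=0..m. C r * f r (Suc j))\<^sup>2)"
proof (rule ccontr)
  define Q where "Q n C = (\<Sum>j<n. (\<Sum>r=0..m. C r * f r (Suc j))\<^sup>2)" for n C
  have Q_mono: "Q N C \<le> Q n C" if "N \<le> n" for N n C
    unfolding Q_def using that by (intro sum_mono2) auto
  have Q_nonneg: "0 \<le> Q n C" for n C
    unfolding Q_def by (intro sum_nonneg) auto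
  have Q_scale: "Q n (\<lambda>r. C r / a) = Q n C / a\<^sup>2" for n C a
    by (simp add: Q_def sum_divide_distrib[symmetric] power_divide)
  assume "\<not> ?thesis"
  then have "\<exists>\<^sub>F n in sequentially. \<exists>C. (\<exists>r\<le>m. 1 \<le> \<bar>C r\<bar>) \<and> Q n C \<le> M"
    by (simp add: not_eventually Q_def not_less)
  \<comment> \<open>A bound at infinitely many \<open>n\<close> is one at every \<open>n\<close>, by monotonicity.\<close>
  then have small: "\<exists>C. (\<exists>r\<le>m. 1 \<le> \<bar>C r\<bar>) \<and> Q n C \<le> M" for n
    unfolding frequently_sequentially using Q_mono by (meson order_trans)
  have "\<exists>D. (\<Sum>r=0..m. \<bar>D r\<bar>) = 1 \<and> Q n D \<le> M" for n
  proof -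
    obtain C q where C: "q \<le> m" "1 \<le> \<bar>C q\<bar>" "Q n C \<le> M"
      using small by blast
    define S where "S = (\<Sum>r=0..m. \<bar>C r\<bar>)"
    have "\<bar>C q\<bar> \<le> S"
      unfolding S_def using C(1) by (intro member_le_sum) auto
    then have S: "1 \<le> S"
      using C(2) by simp
    have "Q n (\<lambda>r. C r / S) \<le> Q n C"
      using S Q_nonneg[of n C] by (simp add: Q_scale divide_le_eq mult_le_cancel_left1)
    moreover have "(\<Sum>r=0..m. \<bar>C r / S\<bar>) = 1"
      using S by (simp add: sum_divide_distrib[symmetric] S_def[symmetric])
    ultimately show ?thesis
      using C(3) by (intro exI[of _ "\<lambda>r. C r / S"]) simp
  qed
  then obtain D where D: "\<And>n. (\<Sum>r=0..m. \<bar>D n r\<bar>) = 1" "\<And>n. Q n (D n) \<le> M"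
    by metis
  have D_bound: "\<bar>D n r\<bar> \<le> 1" if "r \<in> {0..m}" for n r
    using member_le_sum[of r "{0..m}" "\<lambda>r. \<bar>D n r\<bar>"] that D(1)[of n] by auto
  obtain L \<sigma> where \<sigma>: "strict_mono \<sigma>"
    and L: "\<And>r. r \<in> {0..m} \<Longrightarrow> (\<lambda>n. D (\<sigma> n) r) \<longlonglongrightarrow> L r"
    by (rule bounded_sequences_common_convergent_subsequence
        [where D = D and I = "{0..m}", OF finite_atLeastAtMost D_bound]) (assumption, rule that)
  have "(\<lambda>n. \<Sum>r=0..m. \<bar>D (\<sigma> n) r\<bar>) \<longlonglongrightarrow> (\<Sum>r=0..m. \<bar>L r\<bar>)"
    using L by (intro tendsto_intros) auto
  then have "(\<Sum>r=0..m. \<bar>L r\<bar>) = 1"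
    by (simp add: D(1) LIMSEQ_const_iff)
  then have "\<exists>r\<le>m. L r \<noteq> 0"
    by (metis abs_zero atLeastAtMost_iff sum.neutral zero_neq_one)
  moreover have "Q N L \<le> M" for N
  proof (rule tendsto_upperbound)
    show "(\<lambda>n. Q N (D (\<sigma> n))) \<longlonglongrightarrow> Q N L"
      unfolding Q_def using L by (intro tendsto_intros) auto
    have "Q N (D (\<sigma> n)) \<le> M" if "N \<le> n" for n
      using Q_mono[of N "\<sigma> n"] D(2)[of "\<sigma> n"] that seq_suble[OF \<sigma>, of n] by (meson order_trans)
    then show "\<forall>\<^sub>F n in sequentially. Q N (D (\<sigma> n)) \<le> M"
      by (auto simp: eventually_sequentially)
  qed simp
  then have "(\<lambda>k. \<Sum>r=0..m. L r * f r k) \<in> l2_seq"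
    unfolding Q_def by (rule bounded_partial_energies_imp_l2_seq)
  ultimately show False
    using non_l2 by blast
qed

section \<open>Quotients of determinants as values of the quadratic form\<close>

text \<open>
  From \<open>A adj(A) = det A \<cdot> 1\<close>, the column \<open>s\<close> of the adjugate is mapped by \<open>A\<close> to the multiple
  \<open>det A\<close> of the unit vector \<open>e\<^sub>s\<close>, and its entry \<open>s\<close> is the principal minor.  Dividing it by a
  nonzero minor gives \<open>C\<close> with \<open>C\<^sub>s = 1\<close> and form value \<open>C\<^sub>s det A / minor\<close>.  For a zero minor, the
  quotient is \<open>0\<close>, and a kernel vector of the submatrix, scaled to have an entry \<open>1\<close> and extended by
  \<open>0\<close> at \<open>s\<close>, gives the form the value \<open>0\<close>.
\<close>

lemma det_quotient_is_quadratic_form_value: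
  fixes A :: "real mat"
  assumes A: "A \<in> carrier_mat (Suc m) (Suc m)" and s: "s \<le> m"
  shows "\<exists>C. (\<exists>r\<le>m. 1 \<le> \<bar>C r\<bar>) \<and>
           (\<Sum>k=0..m. \<Sum>r=0..m. C k * (A $$ (k, r) * C r)) = det A / det (mat_delete A s s)"
proof (cases "det (mat_delete A s s) = 0")
  case False
  define d where "d = det (mat_delete A s s)"
  define C where "C r = adj_mat A $$ (r, s) / d" for r
  have "C s = 1"
    using A s False by (simp add: C_def d_def adj_mat_def cofactor_def)
  have image: "(\<Sum>r=0..m. A $$ (k, r) * C r) = (if k = s then det A / d else 0)" if "k \<le> m" for k
  proof -
    have "(\<Sum>r=0..m. A $$ (k, r) * adj_mat A $$ (r, s)) = (A * adj_mat A) $$ (k, s)"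
      using that s A adj_mat(1)[OF A]
      by (simp add: scalar_prod_def atLeastLessThanSuc_atLeastAtMost)
    also have "\<dots> = (if k = s then det A else 0)"
      using that s by (simp add: adj_mat(2)[OF A])
    finally show ?thesis
      by (simp add: C_def sum_divide_distrib[symmetric])
  qed
  have "(\<Sum>k=0..m. \<Sum>r=0..m. C k * (A $$ (k, r) * C r))
      = (\<Sum>k=0..m. if k = s then C s * (det A / d) else 0)"
    by (intro sum.cong) (auto simp: sum_distrib_left[symmetric] image)
  also have "\<dots> = det A / d"
    using s \<open>C s = 1\<close> by simp
  finally show ?thesis
    using \<open>C s = 1\<close> s unfolding d_def by (intro exI[of _ C]) auto
next
  case True
  have minor: "mat_delete A s s \<in> carrier_mat m m"
    using mat_delete_carrier[OF A] by simp
  then obtain v where v: "v \<in> carrier_vec m" "v \<noteq> 0\<^sub>v m" "mat_delete A s s *\<^sub>v v = 0\<^sub>v m"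
    using True det_0_iff_vec_prod_zero by blast
  then obtain p where p: "p < m" "v $ p \<noteq> 0"
    by (metis carrier_vecD eq_vecI index_zero_vec)
  define C where "C r = (if r = s then 0 else v $ delete_index s r / v $ p)" for r
  have sum_skip: "(\<Sum>r=0..m. g r) = (\<Sum>i=0..<m. g (insert_index s i))" if "g s = 0"
    for g :: "nat \<Rightarrow> real"
  proof -
    have "(\<Sum>r=0..m. g r) = (\<Sum>r\<in>{0..<Suc m} - {s}. g r)"
      using that s by (intro sum.mono_neutral_right) auto
    also have "\<dots> = (\<Sum>i=0..<m. g (insert_index s i))"
      using s by (simp add: insert_index_image[symmetric] sum.reindex insert_index_inj_on)
    finally show ?thesis .
  qed
  have image: "(\<Sum>r=0..m. A $$ (insert_index s i, r) * C r) = 0" if "i < m" for i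
  proof -
    have "(\<Sum>r=0..m. A $$ (insert_index s i, r) * C r)
        = (\<Sum>j=0..<m. A $$ (insert_index s i, insert_index s j) * C (insert_index s j))"
      by (rule sum_skip) (simp add: C_def)
    also have "\<dots> = (\<Sum>j=0..<m. mat_delete A s s $$ (i, j) * v $ j) / v $ p"
      using that s by (simp add: mat_delete_index[OF A] C_def sum_divide_distrib)
    also have "(\<Sum>j=0..<m. mat_delete A s s $$ (i, j) * v $ j) = (mat_delete A s s *\<^sub>v v) $ i"
      using that carrier_matD[OF A] carrier_vecD[OF v(1)] by (simp add: scalar_prod_def)
    finally show ?thesis
      using that v(3) by simp
  qed
  have "(\<Sum>k=0..m. \<Sum>r=0..m. C k * (A $$ (k, r) * C r))
      = (\<Sum>k=0..m. C k * (\<Sum>r=0..m. A $$ (k, r) * C r))"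
    by (simp add: sum_distrib_left)
  also have "\<dots> = (\<Sum>i=0..<m. C (insert_index s i) *
      (\<Sum>r=0..m. A $$ (insert_index s i, r) * C r))"
    by (rule sum_skip) (simp add: C_def)
  also have "\<dots> = 0"
    by (simp add: image)
  finally have "(\<Sum>k=0..m. \<Sum>r=0..m. C k * (A $$ (k, r) * C r)) = 0" .
  moreover have "C (insert_index s p) = 1" "insert_index s p \<le> m"
    using p by (simp_all add: C_def) (simp add: insert_index_def)
  ultimately show ?thesis
    using True by (intro exI[of _ C]) (auto intro!: exI[of _ "insert_index s p"])
qed

section \<open>Gram matrices of truncated sequences\<close>

lemma gram_form_eq_energy:
  "(\<Sum>k=0..m. \<Sum>r=0..m. C k * (gram_mat (map (\<lambda>r. proj_vec n (f r)) [0..<Suc m]) $$ (k, r) * C r))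
     = (\<Sum>j<n. (\<Sum>r=0..m. C r * f r (Suc j))\<^sup>2)" (is "?lhs = _")
proof -
  have entry: "gram_mat (map (\<lambda>r. proj_vec n (f r)) [0..<Suc m]) $$ (k, r)
      = (\<Sum>j<n. f k (Suc j) * f r (Suc j))" if "k \<le> m" "r \<le> m" for k r
    using that
    by (simp add: gram_mat_def proj_vec_def scalar_prod_def lessThan_atLeast0 nth_append del: upt_Suc)
  have "?lhs = (\<Sum>k=0..m. \<Sum>r=0..m. \<Sum>j<n. (C k * f k (Suc j)) * (C r * f r (Suc j)))"
    by (intro sum.cong) (simp_all add: entry sum_distrib_left sum_distrib_right mult_ac del: upt_Suc)
  also have "\<dots> = (\<Sum>k=0..m. \<Sum>j<n. \<Sum>r=0..m. (C k * f k (Suc j)) * (C r * f r (Suc j)))"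
    by (intro sum.cong refl sum.swap)
  also have "\<dots> = (\<Sum>j<n. \<Sum>k=0..m. \<Sum>r=0..m. (C k * f k (Suc j)) * (C r * f r (Suc j)))"
    by (rule sum.swap)
  also have "\<dots> = (\<Sum>j<n. (\<Sum>r=0..m. C r * f r (Suc j))\<^sup>2)"
    by (simp add: power2_eq_square sum_product)
  finally show ?thesis .
qed

lemma mat_delete_gram_mat:
  assumes "s \<le> m"
  shows "mat_delete (gram_mat (map g [0..<Suc m])) s s = gram_mat (map g ([0..<s] @ [Suc s..<Suc m]))"
proof -
  define ys where "ys = map g ([0..<s] @ [Suc s..<Suc m])"
  have nth: "ys ! i = g (insert_index s i)" if "i < m" for i
    using that assms by (auto simp: ys_def nth_append insert_index_def simp del: upt_Suc)
  have len: "length ys = m"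
    using assms by (simp add: ys_def)
  have "mat_delete (gram_mat (map g [0..<Suc m])) s s = gram_mat ys"
    unfolding gram_mat_def using assms
    by (intro eq_matI) (auto simp: mat_delete_def nth len insert_index_def simp del: upt_Suc)
  then show ?thesis
    by (simp only: ys_def)
qed

theorem lemma1p1:
  fixes m s :: nat
    and f :: "nat \<Rightarrow> nat \<Rightarrow> real"
  assumes "m \<ge> 1"
    and "\<And>C :: nat \<Rightarrow> real. \<exists>r\<le>m. C r \<noteq> 0 \<Longrightarrow> (\<lambda>k. \<Sum>r=0..m. C r * f r k) \<notin> l2_seq"
    and "s \<le> m"
  shows "filterlim
           (\<lambda>n. gram_det (map (\<lambda>r. proj_vec n (f r)) [0..<Suc m]) /
                gram_det (map (\<lambda>r. proj_vec n (f r)) ([0..<s] @ [Suc s..<Suc m])))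
           at_top sequentially"
  unfolding filterlim_at_top_dense
proof
  fix M :: real
  have quotient: "\<exists>C. (\<exists>r\<le>m. 1 \<le> \<bar>C r\<bar>) \<and>
      gram_det (map (\<lambda>r. proj_vec n (f r)) [0..<Suc m]) /
        gram_det (map (\<lambda>r. proj_vec n (f r)) ([0..<s] @ [Suc s..<Suc m]))
      = (\<Sum>j<n. (\<Sum>r=0..m. C r * f r (Suc j))\<^sup>2)" for n
  proof -
    define A where "A = gram_mat (map (\<lambda>r. proj_vec n (f r)) [0..<Suc m])"
    have "A \<in> carrier_mat (Suc m) (Suc m)"
      by (simp add: A_def gram_mat_def)
    from det_quotient_is_quadratic_form_value[OF this assms(3)]
    obtain C where "\<exists>r\<le>m. 1 \<le> \<bar>C r\<bar>"
      and "(\<Sum>k=0..m. \<Sum>r=0..m. C k * (A $$ (k, r) * C r)) = det A / det (mat_delete A s s)"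
      by blast
    then show ?thesis
      unfolding A_def gram_form_eq_energy mat_delete_gram_mat[OF assms(3)] gram_det_def[symmetric]
      by (intro exI[of _ C]) (simp only:)
  qed
  show "\<forall>\<^sub>F n in sequentially. M <
      gram_det (map (\<lambda>r. proj_vec n (f r)) [0..<Suc m]) /
        gram_det (map (\<lambda>r. proj_vec n (f r)) ([0..<s] @ [Suc s..<Suc m]))"
    using uniform_divergence_of_partial_energies[OF assms(2), where M = M]
  proof (rule eventually_mono)
    fix n
    assume large: "\<forall>C. (\<exists>r\<le>m. 1 \<le> \<bar>C r\<bar>) \<longrightarrow>
        M < (\<Sum>j<n. (\<Sum>r=0..m. C r * f r (Suc j))\<^sup>2)"
    obtain C where "\<exists>r\<le>m. 1 \<le> \<bar>C r\<bar>"
      and "gram_det (map (\<lambda>r. proj_vec n (f r)) [0..<Suc m]) /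
        gram_det (map (\<lambda>r. proj_vec n (f r)) ([0..<s] @ [Suc s..<Suc m]))
      = (\<Sum>j<n. (\<Sum>r=0..m. C r * f r (Suc j))\<^sup>2)"
      using quotient by blast
    with large show "M < gram_det (map (\<lambda>r. proj_vec n (f r)) [0..<Suc m]) /
        gram_det (map (\<lambda>r. proj_vec n (f r)) ([0..<s] @ [Suc s..<Suc m]))"
      by (simp only:)
  qed
qed

end
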